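(* Let $G,H\in\mathbb{GS}$. Then $Ls(G+X)\ge Ls(H+X)$ for all $X\in\mathbb{GS}$ if and only if $Rs(G+Y)\ge Rs(H+Y)$ for all $Y\in\mathbb{GS}$.
   Context: A scoring game is written $G=\langle G^{\mathcal L}\mid G^{\mathcal R}\rangle$, where each of $G^{\mathcal L}$ (Left options) and $G^{\mathcal R}$ (Right options) is either a finite nonempty set of scoring games or an atom $\emptyset^{s}$, $s\in\mathbb R$ (the player to move on that side cannot move and the game ends with score $s$); game trees are finite. An atom occurring in $G$ is an atom of $G$ or of any follower of $G$. $G$ is guaranteed if for every follower $K$ of $G$: if $K^{\mathcal L}=\emptyset^\ell$ then $\ell\le s$ for every atom $\emptyset^s$ occurring in $K$, and if $K^{\mathcal R}=\emptyset^r$ then $s\le r$ for every atom $\emptyset^s$ occurring in $K$; $\mathbb{GS}$ is the class of guaranteed games. Disjunctive sum $G+H$: Left options are $G^L+H$ and $G+H^L$, except if both are left-atomic with atoms $\emptyset^{\ell_1},\emptyset^{\ell_2}$, then $(G+H)^{\mathcal L}=\emptyset^{\ell_1+\ell_2}$; Right symmetric. Stops: $Ls(G)=\ell$ if $G^{\mathcal L}=\emptyset^\ell$, otherwise $\max_{G^L}Rs(G^L)$; $Rs(G)=r$ if $G^{\mathcal R}=\emptyset^r$, otherwise $\min_{G^R}Ls(G^R)$. *)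

theory Defs
  imports Complex_Main "HOL-Library.FSet"
begin

datatype 'a side = Atom real | Options "'a fset"

text \<open>The datatype also contains terms with an empty option set; these are excluded by
  \<open>scoring_game\<close> below.\<close>

datatype game = Game (lside: "game side") (rside: "game side")

fun opts :: "'a side \<Rightarrow> 'a fset" where
  "opts (Atom s) = {||}"
| "opts (Options A) = A"

definition left_opts :: "game \<Rightarrow> game fset" where
  "left_opts G = opts (lside G)"

definition right_opts :: "game \<Rightarrow> game fset" where
  "right_opts G = opts (rside G)"

lemma size_opts: "x |\<in>| opts S \<Longrightarrow> size x < size_side size S"
proof (cases S)
  case (Options A)
  assume "x |\<in>| opts S"
  then have "x \<in> fset A" using Options by simp
  then have "Suc (size x) \<le> (\<Sum>y\<in>fset A. Suc (size y))"
    by (intro member_le_sum) auto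
  then show ?thesis using Options by (simp add: size_fset_simps)
qed simp

lemma size_left_opts [termination_simp]: "x |\<in>| left_opts G \<Longrightarrow> size x < size G"
  by (cases G) (auto simp: left_opts_def dest: size_opts)

lemma size_right_opts [termination_simp]: "x |\<in>| right_opts G \<Longrightarrow> size x < size G"
  by (cases G) (auto simp: right_opts_def dest: size_opts)

text \<open>Every game is a follower of itself; the moves leading to a follower need not alternate.\<close>

inductive follower :: "game \<Rightarrow> game \<Rightarrow> bool" for G where
  refl: "follower G G"
| left: "follower G K \<Longrightarrow> K' |\<in>| left_opts K \<Longrightarrow> follower G K'"
| right: "follower G K \<Longrightarrow> K' |\<in>| right_opts K \<Longrightarrow> follower G K'"

definition scoring_game :: "game \<Rightarrow> bool" where
  "scoring_game G \<longleftrightarrow>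
    (\<forall>K. follower G K \<longrightarrow> lside K \<noteq> Options {||} \<and> rside K \<noteq> Options {||})"

definition atoms :: "game \<Rightarrow> real set" where
  "atoms G = {s. \<exists>K. follower G K \<and> (lside K = Atom s \<or> rside K = Atom s)}"

definition guaranteed :: "game \<Rightarrow> bool" where
  "guaranteed G \<longleftrightarrow>
    (\<forall>K. follower G K \<longrightarrow>
      (\<forall>l. lside K = Atom l \<longrightarrow> (\<forall>s\<in>atoms K. l \<le> s)) \<and>
      (\<forall>r. rside K = Atom r \<longrightarrow> (\<forall>s\<in>atoms K. s \<le> r)))"

definition GS :: "game set" where
  "GS = {G. scoring_game G \<and> guaranteed G}"

function gsum :: "game \<Rightarrow> game \<Rightarrow> game" where
  "gsum G H = Game
    (case (lside G, lside H) of
       (Atom l1, Atom l2) \<Rightarrow> Atom (l1 + l2)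
     | _ \<Rightarrow> Options ((\<lambda>G'. gsum G' H) |`| left_opts G |\<union>| (\<lambda>H'. gsum G H') |`| left_opts H))
    (case (rside G, rside H) of
       (Atom r1, Atom r2) \<Rightarrow> Atom (r1 + r2)
     | _ \<Rightarrow> Options ((\<lambda>G'. gsum G' H) |`| right_opts G |\<union>| (\<lambda>H'. gsum G H') |`| right_opts H))"
  by auto
termination
  by (relation "measure (\<lambda>(G, H). size G + size H)")
    (auto dest: size_left_opts size_right_opts)

declare gsum.simps [simp del]

instantiation game :: plus
begin
definition plus_game :: "game \<Rightarrow> game \<Rightarrow> game" where
  "G + H = gsum G H"
instance ..
end

function Ls :: "game \<Rightarrow> real" and Rs :: "game \<Rightarrow> real" where
  "Ls G = (case lside G of Atom l \<Rightarrow> l | Options _ \<Rightarrow> Max (Rs ` fset (left_opts G)))"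
| "Rs G = (case rside G of Atom r \<Rightarrow> r | Options _ \<Rightarrow> Min (Ls ` fset (right_opts G)))"
  by pat_completeness auto
termination
  by (relation "measure (case_sum size size)")
    (auto dest: size_left_opts size_right_opts)

declare Ls.simps [simp del] Rs.simps [simp del]

end

theory Submission
  imports Defs
begin

text \<open>For the direction from left stops to right stops, give Left the single extra move to \<open>Y\<close> and
  Right the threat of moving to the number \<open>-N\<close>. If \<open>N\<close> is large, Left has to answer the threat at
  once by moving to \<open>Y\<close>, so the test game \<open>X = \<langle>Y | -N\<rangle>\<close> satisfies \<open>Ls (G + X) = Rs (G + Y)\<close>
  and \<open>Ls (H + X) = Rs (H + Y)\<close>. No side of \<open>X\<close> itself is an atom, hence \<open>X\<close> is guaranteed
  whenever \<open>Y\<close> is. The other direction uses \<open>\<langle>N | X\<rangle>\<close>.\<close>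

text \<open>The usual embedding of the reals into scoring games.\<close>

definition number :: "real \<Rightarrow> game" where
  "number c = Game (Atom c) (Atom c)"

definition switch :: "game \<Rightarrow> game \<Rightarrow> game" where
  "switch A B = Game (Options {|A|}) (Options {|B|})"

lemma number_simps [simp]:
  "lside (number c) = Atom c" "rside (number c) = Atom c"
  "left_opts (number c) = {||}" "right_opts (number c) = {||}"
  by (simp_all add: number_def left_opts_def right_opts_def)

lemma switch_simps [simp]:
  "lside (switch A B) = Options {|A|}" "rside (switch A B) = Options {|B|}"
  "left_opts (switch A B) = {|A|}" "right_opts (switch A B) = {|B|}"
  by (simp_all add: switch_def left_opts_def right_opts_def)

lemma follower_number: "follower (number c) K \<Longrightarrow> K = number c"
  by (induction rule: follower.induct) simp_all

lemma number_in_GS: "number c \<in> GS"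
  by (auto simp: GS_def scoring_game_def guaranteed_def atoms_def dest!: follower_number)

lemma follower_switch:
  "follower (switch A B) K \<Longrightarrow> K = switch A B \<or> follower A K \<or> follower B K"
  by (induction rule: follower.induct) (auto intro: follower.intros)

text \<open>Below the root every follower lies in \<open>A\<close> or \<open>B\<close>, and the
  condition there concerns only the atoms of that follower itself, so it carries over
  unchanged.\<close>

lemma switch_in_GS:
  assumes "A \<in> GS" "B \<in> GS"
  shows "switch A B \<in> GS"
proof -
  have "scoring_game (switch A B)"
    using assms by (auto simp: GS_def scoring_game_def dest!: follower_switch)
  moreover have "guaranteed (switch A B)"
    unfolding guaranteed_def
  proof (intro allI impI)
    fix K
    assume "follower (switch A B) K"
    then consider "K = switch A B" | "follower A K" | "follower B K"
      using follower_switch by blast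
    then show "(\<forall>l. lside K = Atom l \<longrightarrow> (\<forall>s\<in>atoms K. l \<le> s)) \<and>
      (\<forall>r. rside K = Atom r \<longrightarrow> (\<forall>s\<in>atoms K. s \<le> r))"
      using assms by cases (simp_all add: GS_def guaranteed_def)
  qed
  ultimately show ?thesis by (simp add: GS_def)
qed

lemma lside_plus:
  "lside (G + H) = (case (lside G, lside H) of
       (Atom l1, Atom l2) \<Rightarrow> Atom (l1 + l2)
     | _ \<Rightarrow> Options ((\<lambda>G'. G' + H) |`| left_opts G |\<union>| (\<lambda>H'. G + H') |`| left_opts H))"
  unfolding plus_game_def by (subst gsum.simps) simp

lemma rside_plus:
  "rside (G + H) = (case (rside G, rside H) of
       (Atom r1, Atom r2) \<Rightarrow> Atom (r1 + r2)
     | _ \<Rightarrow> Options ((\<lambda>G'. G' + H) |`| right_opts G |\<union>| (\<lambda>H'. G + H') |`| right_opts H))"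
  unfolding plus_game_def by (subst gsum.simps) simp

lemma Ls_Atom: "lside G = Atom l \<Longrightarrow> Ls G = l"
  by (simp add: Ls.simps)

lemma Rs_Atom: "rside G = Atom r \<Longrightarrow> Rs G = r"
  by (simp add: Rs.simps)

lemma Ls_Options: "lside G = Options A \<Longrightarrow> Ls G = Max (Rs ` fset A)"
  by (simp add: Ls.simps left_opts_def)

lemma Rs_Options: "rside G = Options A \<Longrightarrow> Rs G = Min (Ls ` fset A)"
  by (simp add: Rs.simps right_opts_def)

lemma follower_trans: "follower H K \<Longrightarrow> follower G H \<Longrightarrow> follower G K"
  by (induction rule: follower.induct) (auto intro: follower.intros)

lemma scoring_game_left_opts: "scoring_game G \<Longrightarrow> K |\<in>| left_opts G \<Longrightarrow> scoring_game K"
  unfolding scoring_game_def by (meson follower.left follower.refl follower_trans)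

lemma scoring_game_right_opts: "scoring_game G \<Longrightarrow> K |\<in>| right_opts G \<Longrightarrow> scoring_game K"
  unfolding scoring_game_def by (meson follower.right follower.refl follower_trans)

text \<open>\<open>number c\<close> offers no moves, so play in the sum is play in \<open>G\<close>,
  and \<open>c\<close> is added when an atom ends it. Both stops share one induction because each is
  computed from the other at the options. \<open>scoring_game G\<close> makes the option sets
  nonempty, so that \<open>Max\<close> and \<open>Min\<close> commute with adding
  \<open>c\<close>.\<close>

lemma stops_plus_number:
  "scoring_game G \<Longrightarrow> Ls (G + number c) = Ls G + c \<and> Rs (G + number c) = Rs G + c"
proof (induction G rule: measure_induct_rule[where f = size])
  case (less G)
  have "Ls (G + number c) = Ls G + c"
  proof (cases "lside G")
    case (Atom l)
    then have "lside (G + number c) = Atom (l + c)" by (simp add: lside_plus)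
    then show ?thesis using Atom by (simp add: Ls_Atom)
  next
    case (Options A)
    then have A: "left_opts G = A" by (simp add: left_opts_def)
    have ne: "A \<noteq> {||}"
      using less.prems Options follower.refl by (auto simp: scoring_game_def)
    have IH: "Rs (K + number c) = Rs K + c" if "K |\<in>| A" for K
      using less size_left_opts scoring_game_left_opts that A by blast
    have "lside (G + number c) = Options ((\<lambda>K. K + number c) |`| A)"
      using Options A by (simp add: lside_plus)
    then have "Ls (G + number c) = Max ((\<lambda>K. Rs (K + number c)) ` fset A)"
      by (simp add: Ls_Options image_image)
    also have "\<dots> = Max ((\<lambda>K. Rs K + c) ` fset A)"
      using IH by (metis (no_types, lifting) image_cong)
    also have "\<dots> = Max (Rs ` fset A) + c"
      using ne by (intro Max_add_commute) (auto simp: bot_fset.rep_eq fset_inject[symmetric])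
    finally show ?thesis using Options by (simp add: Ls_Options)
  qed
  moreover have "Rs (G + number c) = Rs G + c"
  proof (cases "rside G")
    case (Atom r)
    then have "rside (G + number c) = Atom (r + c)" by (simp add: rside_plus)
    then show ?thesis using Atom by (simp add: Rs_Atom)
  next
    case (Options A)
    then have A: "right_opts G = A" by (simp add: right_opts_def)
    have ne: "A \<noteq> {||}"
      using less.prems Options follower.refl by (auto simp: scoring_game_def)
    have IH: "Ls (K + number c) = Ls K + c" if "K |\<in>| A" for K
      using less size_right_opts scoring_game_right_opts that A by blast
    have "rside (G + number c) = Options ((\<lambda>K. K + number c) |`| A)"
      using Options A by (simp add: rside_plus)
    then have "Rs (G + number c) = Min ((\<lambda>K. Ls (K + number c)) ` fset A)"
      by (simp add: Rs_Options image_image)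
    also have "\<dots> = Min ((\<lambda>K. Ls K + c) ` fset A)"
      using IH by (metis (no_types, lifting) image_cong)
    also have "\<dots> = Min (Ls ` fset A) + c"
      using ne by (intro Min_add_commute) (auto simp: bot_fset.rep_eq fset_inject[symmetric])
    finally show ?thesis using Options by (simp add: Rs_Options)
  qed
  ultimately show ?case by simp
qed

text \<open>A switch is not atomic on either side, so neither is the sum, even if \<open>G\<close>
  is left-atomic; in that case \<open>left_opts G\<close> is empty and \<open>G + A\<close> is the
  only option.\<close>

lemma lside_plus_switch:
  "lside (G + switch A B) = Options (finsert (G + A) ((\<lambda>K. K + switch A B) |`| left_opts G))"
  by (simp add: lside_plus split: side.split)

lemma rside_plus_switch:
  "rside (G + switch A B) = Options (finsert (G + B) ((\<lambda>K. K + switch A B) |`| right_opts G))"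
  by (simp add: rside_plus split: side.split)

lemma Ls_plus_switch:
  "Ls (G + switch A B) = Max (insert (Rs (G + A)) ((\<lambda>K. Rs (K + switch A B)) ` fset (left_opts G)))"
  by (simp add: Ls_Options[OF lside_plus_switch] image_image)

lemma Rs_plus_switch:
  "Rs (G + switch A B) = Min (insert (Ls (G + B)) ((\<lambda>K. Ls (K + switch A B)) ` fset (right_opts G)))"
  by (simp add: Rs_Options[OF rside_plus_switch] image_image)

text \<open>The assumption says how large \<open>N\<close> must be: if Left moves in
  \<open>G\<close> to \<open>K\<close> instead, Right can carry out the threat, which leaves
  \<open>K + number (- N)\<close> with Left to move, worth \<open>Ls K - N\<close>.\<close>

lemma Ls_plus_threat:
  assumes "scoring_game G" "\<And>K. K |\<in>| left_opts G \<Longrightarrow> Ls K - N \<le> Rs (G + Y)"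
  shows "Ls (G + switch Y (number (- N))) = Rs (G + Y)"
proof -
  let ?X = "switch Y (number (- N))"
  have "Rs (K + ?X) \<le> Rs (G + Y)" if K: "K |\<in>| left_opts G" for K
  proof -
    \<comment> \<open>Carrying out the threat is one of the options over which Right
      minimizes.\<close>
    have "Rs (K + ?X) \<le> Ls (K + number (- N))"
      by (simp add: Rs_plus_switch)
    also have "\<dots> = Ls K - N"
      using stops_plus_number scoring_game_left_opts[OF assms(1) K] by simp
    finally show ?thesis using assms(2)[OF K] by simp
  qed
  then show ?thesis
    \<comment> \<open>The bound is attained by the inserted element, Left's move to
      \<open>Y\<close>.\<close>
    unfolding Ls_plus_switch by (intro Max_eqI) auto
qed

text \<open>The mirror image: now Left threatens to move to \<open>N\<close>, and Right's answer is
  the move to \<open>X\<close>.\<close>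

lemma Rs_plus_threat:
  assumes "scoring_game G" "\<And>K. K |\<in>| right_opts G \<Longrightarrow> Ls (G + X) \<le> Rs K + N"
  shows "Rs (G + switch (number N) X) = Ls (G + X)"
proof -
  let ?Y = "switch (number N) X"
  have "Ls (G + X) \<le> Ls (K + ?Y)" if K: "K |\<in>| right_opts G" for K
  proof -
    have "Ls (G + X) \<le> Rs K + N" by (rule assms(2)[OF K])
    also have "\<dots> = Rs (K + number N)"
      using stops_plus_number scoring_game_right_opts[OF assms(1) K] by simp
    also have "\<dots> \<le> Ls (K + ?Y)"
      by (simp add: Ls_plus_switch)
    finally show ?thesis .
  qed
  then show ?thesis
    unfolding Rs_plus_switch by (intro Min_eqI) auto
qed

text \<open>Lower bounds on \<open>N\<close> are phrased as eventual properties so that the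
  requirements from \<open>G\<close> and from \<open>H\<close> combine by
  \<open>eventually_conj\<close>; an empty \<open>A\<close> needs no separate case.\<close>

lemma eventually_ge_on_fset:
  fixes f :: "'a \<Rightarrow> real"
  shows "eventually (\<lambda>N. \<forall>x. x |\<in>| A \<longrightarrow> f x \<le> N) at_top"
  using eventually_ball_finite[of "fset A" "\<lambda>N x. f x \<le> N" at_top]
  by (simp add: eventually_ge_at_top Ball_def)

text \<open>The point is that one \<open>X\<close> serves both games, so that a comparison of
  \<open>G\<close> with \<open>H\<close> carries over; hence \<open>N\<close> must be large enough
  for both at once.\<close>

lemma exists_Ls_test:
  assumes "G \<in> GS" "H \<in> GS" "Y \<in> GS"
  shows "\<exists>X\<in>GS. Ls (G + X) = Rs (G + Y) \<and> Ls (H + X) = Rs (H + Y)"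
proof -
  have "\<exists>N. (\<forall>K. K |\<in>| left_opts G \<longrightarrow> Ls K - Rs (G + Y) \<le> N) \<and>
    (\<forall>K. K |\<in>| left_opts H \<longrightarrow> Ls K - Rs (H + Y) \<le> N)"
    by (intro eventually_happens'[OF trivial_limit_at_top_linorder]
        eventually_conj eventually_ge_on_fset)
  then obtain N where
    "\<And>K. K |\<in>| left_opts G \<Longrightarrow> Ls K - Rs (G + Y) \<le> N"
    "\<And>K. K |\<in>| left_opts H \<Longrightarrow> Ls K - Rs (H + Y) \<le> N"
    by blast
  then have "Ls (G + switch Y (number (- N))) = Rs (G + Y)"
    "Ls (H + switch Y (number (- N))) = Rs (H + Y)"
    using assms by (auto intro!: Ls_plus_threat simp: GS_def algebra_simps)
  then show ?thesis
    using switch_in_GS[OF assms(3) number_in_GS] by blast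
qed

lemma exists_Rs_test:
  assumes "G \<in> GS" "H \<in> GS" "X \<in> GS"
  shows "\<exists>Y\<in>GS. Rs (G + Y) = Ls (G + X) \<and> Rs (H + Y) = Ls (H + X)"
proof -
  have "\<exists>N. (\<forall>K. K |\<in>| right_opts G \<longrightarrow> Ls (G + X) - Rs K \<le> N) \<and>
    (\<forall>K. K |\<in>| right_opts H \<longrightarrow> Ls (H + X) - Rs K \<le> N)"
    by (intro eventually_happens'[OF trivial_limit_at_top_linorder]
        eventually_conj eventually_ge_on_fset)
  then obtain N where
    "\<And>K. K |\<in>| right_opts G \<Longrightarrow> Ls (G + X) - Rs K \<le> N"
    "\<And>K. K |\<in>| right_opts H \<Longrightarrow> Ls (H + X) - Rs K \<le> N"
    by blast
  then have "Rs (G + switch (number N) X) = Ls (G + X)"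
    "Rs (H + switch (number N) X) = Ls (H + X)"
    using assms by (auto intro!: Rs_plus_threat simp: GS_def algebra_simps)
  then show ?thesis
    using switch_in_GS[OF number_in_GS assms(3)] by blast
qed

theorem theorem19:
  fixes G H :: game
  assumes "G \<in> GS" and "H \<in> GS"
  shows "(\<forall>X\<in>GS. Ls (G + X) \<ge> Ls (H + X)) \<longleftrightarrow> (\<forall>Y\<in>GS. Rs (G + Y) \<ge> Rs (H + Y))"
  \<comment> \<open>Given \<open>Y\<close>, the first fact supplies an \<open>X\<close> whose left
    stops are the right stops to be compared; given \<open>X\<close>, the second supplies such a
    \<open>Y\<close> for the converse.\<close>
  using exists_Ls_test[OF assms] exists_Rs_test[OF assms] by metis

end
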